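(* Let $\alpha>1$, $L_1,L_2>0$, let $K_1\subset\mathbb{R}^n$ be a closed interval, $K_2$ an $m$-dimensional compact set, $K=K_1\times K_2$, and $\lambda_0\in K_1$. Let $\varphi(\lambda,x)\in G^{\alpha,L_1,L_2}(K)$, regarded as a map $\lambda\mapsto\varphi(\lambda,\cdot)$ from $K_1$ to the Banach algebra $G^{\alpha,L_2}(K_2)$. Then the Taylor series $$\widetilde\varphi(\lambda_0+\Delta\lambda,x)=\sum_{k=0}^\infty\frac1{k!}\big(\Delta\lambda_1\partial_{\lambda_1}+\cdots+\Delta\lambda_n\partial_{\lambda_n}\big)^k\varphi(\lambda_0,x)$$ is a Gevrey-$(\alpha,L_1)$ asymptotic expansion of $\varphi$ at $\lambda_0$ (with values in $V=G^{\alpha,L_2}(K_2)$).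
   Context: A closed interval in $\mathbb{R}^n$ is a closed cube with sides parallel to the axes. An $m$-dimensional compact set is one of the form $K'\times\mathbb{T}^{m_2}$ with $K'\subset\mathbb{R}^{m_1}$ compact, $m_1+m_2=m$. For such sets, $$\|\varphi\|_{\alpha,L_1,L_2}=\sum_{k_1\in\mathbb{N}^n,k_2\in\mathbb{N}^m}\Big(\frac{L_1^{|k_1|_1}L_2^{|k_2|_1}}{k_1!\,k_2!}\Big)^\alpha\|\partial_\lambda^{k_1}\partial_x^{k_2}\varphi\|_{C^0(K)},$$ and $G^{\alpha,L_1,L_2}(K)$ is the set of $\varphi\in C^\infty(K)$ for which this is finite; similarly $\|\psi\|_{\alpha,L_2}=\sum_{k\in\mathbb{N}^m}(L_2^{|k|_1}/k!)^\alpha\|\partial^k\psi\|_{C^0(K_2)}$ and $G^{\alpha,L_2}(K_2)$ is the set of $\psi\in C^\infty(K_2)$ with finite norm. Here $|k|_1=\sum_j|k_j|$, $k!=\prod_jk_j!$. Definition. Let $I\subset\mathbb{R}^n$ be a closed interval, $\lambda_0\in I$, $(V,\|\cdot\|_V)$ a Banach algebra and $\varphi:I\to V$. The formal series $\sum_{k\in\mathbb{N}^n}(\lambda-\lambda_0)^k\varphi_k$, with $\varphi_k\in V$, is a Gevrey-$(\alpha,L)$ asymptotic expansion of $\varphi$ at $\lambda_0$ if there is a constant $C$ such that for all $\lambda\in I$ and all integers $p>0$, $$\Big\|\varphi(\lambda)-\sum_{|k|_1<p}(\lambda-\lambda_0)^k\varphi_k\Big\|_V\le C\,p!^{\alpha-1}L^{-p\alpha}|\lambda-\lambda_0|_1^p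 .$$ *)

theory Defs
  imports "HOL-Analysis.Analysis"
begin

text \<open>Multi-indices in \<open>\<nat>\<^sup>n\<close> are functions \<open>'n \<Rightarrow> nat\<close> on a finite index type with \<open>n\<close> elements.\<close>

definition mi_abs :: "('n::finite \<Rightarrow> nat) \<Rightarrow> nat" where
  "mi_abs k = (\<Sum>i\<in>UNIV. k i)"

definition mi_fact :: "('n::finite \<Rightarrow> nat) \<Rightarrow> real" where
  "mi_fact k = (\<Prod>i\<in>UNIV. fact (k i))"

definition mi_pow :: "real^'n \<Rightarrow> ('n::finite \<Rightarrow> nat) \<Rightarrow> real" where
  "mi_pow v k = (\<Prod>i\<in>UNIV. (v $ i) ^ k i)"

definition norm1 :: "real^'n \<Rightarrow> real" where
  "norm1 v = (\<Sum>i\<in>UNIV. \<bar>v $ i\<bar>)"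

definition closed_cube :: "(real^'n) set \<Rightarrow> bool" where
  "closed_cube I \<longleftrightarrow> (\<exists>a s. 0 < s \<and> I = cbox a (a + vec s))"

definition partial_deriv :: "'n::finite \<Rightarrow> (real^'n \<Rightarrow> real) \<Rightarrow> real^'n \<Rightarrow> real" where
  "partial_deriv i f x = deriv (\<lambda>t. f (x + t *\<^sub>R axis i 1)) 0"

text \<open>The partial derivatives are taken in some fixed order of the coordinates; by the symmetry
  of higher derivatives the choice is irrelevant at points near which \<open>f\<close> is smooth.\<close>

definition coords :: "'n::finite list" where
  "coords = (SOME xs. distinct xs \<and> set xs = UNIV)"

definition mi_deriv :: "('n::finite \<Rightarrow> nat) \<Rightarrow> (real^'n \<Rightarrow> real) \<Rightarrow> real^'n \<Rightarrow> real" where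
  "mi_deriv k f = foldr (\<lambda>i. partial_deriv i ^^ k i) coords f"

text \<open>The operator \<open>v\<^sub>1 \<partial>\<^sub>1 + \<dots> + v\<^sub>n \<partial>\<^sub>n\<close>.\<close>

definition dir_op :: "real^'n::finite \<Rightarrow> (real^'n \<Rightarrow> real) \<Rightarrow> real^'n \<Rightarrow> real" where
  "dir_op v f = (\<lambda>x. \<Sum>i\<in>UNIV. v $ i * partial_deriv i f x)"

text \<open>\<open>C\<^sup>r\<close> and \<open>C\<^sup>\<infinity>\<close> functions on an open set.\<close>

fun differentiable_times_on :: "nat \<Rightarrow> 'a::euclidean_space set \<Rightarrow> ('a \<Rightarrow> real) \<Rightarrow> bool" where
  "differentiable_times_on 0 U f \<longleftrightarrow> continuous_on U f"
| "differentiable_times_on (Suc r) U f \<longleftrightarrow>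
     (\<forall>x\<in>U. f differentiable (at x)) \<and>
     (\<forall>v. differentiable_times_on r U (\<lambda>x. frechet_derivative f (at x) v))"

definition smooth_on :: "'a::euclidean_space set \<Rightarrow> ('a \<Rightarrow> real) \<Rightarrow> bool" where
  "smooth_on U f \<longleftrightarrow> (\<forall>r. differentiable_times_on r U f)"

text \<open>A function in \<open>C\<^sup>\<infinity>(K)\<close> is given by a representative that is smooth on an open neighbourhood
  of \<open>K\<close>; its derivatives on \<open>K\<close> are those of the representative. Values outside that
  neighbourhood play no role.\<close>

definition smooth_near :: "'a::euclidean_space set \<Rightarrow> ('a \<Rightarrow> real) \<Rightarrow> bool" where
  "smooth_near K f \<longleftrightarrow> (\<exists>U. open U \<and> K \<subseteq> U \<and> smooth_on U f)"

text \<open>An \<open>m\<close>-dimensional compact set \<open>K' \<times> \<bbbT>\<^bsup>m\<^sub>2\<^esup>\<close> is described by the set \<open>P\<close> of its \<open>m\<^sub>2\<close> angular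
  coordinates and by \<open>K'\<close>, which sits in the coordinate subspace \<open>x\<^sub>j = 0\<close> \<open>(j \<in> P)\<close>, a copy of
  \<open>\<real>\<^bsup>m\<^sub>1\<^esup>\<close>. With \<open>\<bbbT> = \<real>/\<int>\<close>, functions on it are functions on its preimage in \<open>\<real>\<^sup>m\<close> that are
  1-periodic in the angular coordinates. Both \<open>P = {}\<close> and \<open>P = UNIV\<close> are allowed.\<close>

definition compact_base :: "'m::finite set \<Rightarrow> (real^'m) set \<Rightarrow> bool" where
  "compact_base P K' \<longleftrightarrow> compact K' \<and> (\<forall>x\<in>K'. \<forall>j\<in>P. x $ j = 0)"

definition torus_lift :: "'m::finite set \<Rightarrow> (real^'m) set \<Rightarrow> (real^'m) set" where
  "torus_lift P K' = {x. (\<chi> j. if j \<in> P then 0 else x $ j) \<in> K'}"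

definition angle_periodic :: "'m::finite set \<Rightarrow> (real^'m \<Rightarrow> real) \<Rightarrow> bool" where
  "angle_periodic P f \<longleftrightarrow> (\<forall>x. \<forall>j\<in>P. f (x + axis j 1) = f x)"

definition C0_norm :: "'a set \<Rightarrow> ('a \<Rightarrow> real) \<Rightarrow> ennreal" where
  "C0_norm K f = (SUP z\<in>K. ennreal \<bar>f z\<bar>)"

definition gevrey_norm ::
  "real \<Rightarrow> real \<Rightarrow> (real^'m::finite) set \<Rightarrow> (real^'m \<Rightarrow> real) \<Rightarrow> ennreal" where
  "gevrey_norm \<alpha> L K f =
     (\<Sum>\<^sub>\<infinity>k\<in>UNIV. ennreal ((L ^ mi_abs k / mi_fact k) powr \<alpha>) * C0_norm K (mi_deriv k f))"

definition gevrey_space ::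
  "real \<Rightarrow> real \<Rightarrow> 'm::finite set \<Rightarrow> (real^'m) set \<Rightarrow> (real^'m \<Rightarrow> real) set" where
  "gevrey_space \<alpha> L P K' =
     {f. angle_periodic P f \<and> smooth_near (torus_lift P K') f
         \<and> gevrey_norm \<alpha> L (torus_lift P K') f < \<infinity>}"

definition gevrey_norm2 ::
  "real \<Rightarrow> real \<Rightarrow> real \<Rightarrow> ((real^'n::finite) \<times> (real^'m::finite)) set
     \<Rightarrow> (real^'n \<Rightarrow> real^'m \<Rightarrow> real) \<Rightarrow> ennreal" where
  "gevrey_norm2 \<alpha> L1 L2 K \<phi> =
     (\<Sum>\<^sub>\<infinity>(k1, k2)\<in>UNIV.
        ennreal ((L1 ^ mi_abs k1 * L2 ^ mi_abs k2 / (mi_fact k1 * mi_fact k2)) powr \<alpha>)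
        * C0_norm K (\<lambda>(l, x). mi_deriv k1 (\<lambda>l'. mi_deriv k2 (\<phi> l') x) l))"

definition gevrey_space2 ::
  "real \<Rightarrow> real \<Rightarrow> real \<Rightarrow> (real^'n::finite) set \<Rightarrow> 'm::finite set \<Rightarrow> (real^'m) set
     \<Rightarrow> (real^'n \<Rightarrow> real^'m \<Rightarrow> real) set" where
  "gevrey_space2 \<alpha> L1 L2 K1 P K' =
     {\<phi>. (\<forall>l. angle_periodic P (\<phi> l))
         \<and> smooth_near (K1 \<times> torus_lift P K') (\<lambda>(l, x). \<phi> l x)
         \<and> gevrey_norm2 \<alpha> L1 L2 (K1 \<times> torus_lift P K') \<phi> < \<infinity>}"

text \<open>Gevrey asymptotic expansions for an algebra \<open>V\<close> of real functions with pointwise operations.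
  The norm \<open>N\<close> is defined on all functions and finite on \<open>V\<close>.\<close>

definition gevrey_asymptotic_expansion ::
  "('x \<Rightarrow> real) set \<Rightarrow> (('x \<Rightarrow> real) \<Rightarrow> ennreal) \<Rightarrow> real \<Rightarrow> real \<Rightarrow> (real^'n::finite) set
     \<Rightarrow> (real^'n \<Rightarrow> 'x \<Rightarrow> real) \<Rightarrow> real^'n \<Rightarrow> (('n \<Rightarrow> nat) \<Rightarrow> 'x \<Rightarrow> real) \<Rightarrow> bool" where
  "gevrey_asymptotic_expansion V N \<alpha> L I \<phi> l0 c \<longleftrightarrow>
     (\<forall>l\<in>I. \<phi> l \<in> V) \<and> (\<forall>k. c k \<in> V) \<and>
     (\<exists>C::real. \<forall>l\<in>I. \<forall>p>0.
        N (\<lambda>x. \<phi> l x - (\<Sum>k | mi_abs k < p. mi_pow (l - l0) k * c k x))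
        \<le> ennreal (C * fact p powr (\<alpha> - 1) * L powr (- (real p * \<alpha>)) * norm1 (l - l0) ^ p))"

definition taylor_coeff ::
  "(real^'n::finite \<Rightarrow> 'x \<Rightarrow> real) \<Rightarrow> real^'n \<Rightarrow> ('n \<Rightarrow> nat) \<Rightarrow> 'x \<Rightarrow> real" where
  "taylor_coeff \<phi> l0 k x = mi_deriv k (\<lambda>l. \<phi> l x) l0 / mi_fact k"

end

theory Submission
  imports Defs
begin

text \<open>Fix \<open>k\<^sub>2\<close> and \<open>x\<close>. Since mixed derivatives commute, \<open>\<partial>\<^sub>x\<^bsup>k\<^sub>2\<^esup>\<close> of the Taylor remainder of \<open>\<phi>\<close> of order
  \<open>p\<close> is the Taylor remainder of \<open>\<lambda> \<mapsto> \<partial>\<^sub>x\<^bsup>k\<^sub>2\<^esup> \<phi>(\<lambda>,x)\<close>, and Lagrange's form bounds it by the sum over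
  \<open>|k| = p\<close> of \<open>|(\<lambda> - \<lambda>\<^sub>0)\<^sup>k| / k!\<close> times the sup norm of \<open>\<partial>\<^sub>\<lambda>\<^sup>k \<partial>\<^sub>x\<^bsup>k\<^sub>2\<^esup> \<phi>\<close>. Because \<open>k! \<le> p!\<close> and \<open>\<alpha> > 1\<close>, that
  coefficient is at most \<open>p!\<^bsup>\<alpha>-1\<^esup> L\<^sub>1\<^bsup>-p\<alpha>\<^esup> |\<lambda> - \<lambda>\<^sub>0|\<^sub>1\<^sup>p\<close> times the weight \<open>(L\<^sub>1\<^sup>p / k!)\<^sup>\<alpha>\<close> in the norm of
  \<open>\<phi>\<close>. Summing over \<open>k\<^sub>2\<close>, the constant of the expansion can be taken to be the norm of \<open>\<phi>\<close>.\<close>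

subsection \<open>Directional derivatives of smooth functions\<close>

text \<open>Follows the recursion in \<open>differentiable_times_on\<close> and makes sense on
  product spaces, where parameter and space derivatives are the same operator in different
  directions.\<close>

definition ddir :: "'a::euclidean_space \<Rightarrow> ('a \<Rightarrow> real) \<Rightarrow> 'a \<Rightarrow> real" where
  "ddir v f = (\<lambda>x. frechet_derivative f (at x) v)"

text \<open>Functions that agree near a point have the same derivatives there, and
  \<open>frechet_derivative\<close> is a choice among these; points of non-differentiability are
  covered too.\<close>

lemma ddir_cong:
  assumes "open U" "x \<in> U" "\<And>y. y \<in> U \<Longrightarrow> f y = g y"
  shows "ddir v f x = ddir v g x"
proof -
  have "(f has_derivative F) (at x) \<longleftrightarrow> (g has_derivative F) (at x)" for F
    using has_derivative_transform_within_open[OF _ assms(1,2)] assms(3) by metis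
  then show ?thesis
    by (simp add: ddir_def frechet_derivative_def)
qed

lemma differentiable_times_on_cong:
  assumes "open U" "\<And>y. y \<in> U \<Longrightarrow> f y = g y" "differentiable_times_on r U f"
  shows "differentiable_times_on r U g"
  using assms(2,3)
proof (induction r arbitrary: f g)
  case 0
  then show ?case by (metis continuous_on_cong differentiable_times_on.simps(1))
next
  case (Suc r)
  have "g differentiable at x" if "x \<in> U" for x
    using Suc.prems that assms(1) has_derivative_transform_within_open[OF _ assms(1) that]
    unfolding differentiable_def differentiable_times_on.simps(2) by metis
  moreover have "differentiable_times_on r U (ddir v g)" for v
  proof (rule Suc.IH)
    show "ddir v f y = ddir v g y" if "y \<in> U" for y
      by (rule ddir_cong[OF assms(1) that]) (rule Suc.prems(1))
    show "differentiable_times_on r U (ddir v f)"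
      using Suc.prems(2) by (simp add: ddir_def)
  qed
  ultimately show ?case
    unfolding ddir_def differentiable_times_on.simps by blast
qed

lemma smooth_on_cong:
  assumes "open U" "\<And>y. y \<in> U \<Longrightarrow> f y = g y" "smooth_on U f"
  shows "smooth_on U g"
  using assms differentiable_times_on_cong unfolding smooth_on_def by blast

lemma smooth_on_imp_differentiable: "smooth_on U f \<Longrightarrow> x \<in> U \<Longrightarrow> f differentiable (at x)"
  unfolding smooth_on_def by (metis differentiable_times_on.simps(2))

lemma smooth_on_ddir: "smooth_on U f \<Longrightarrow> smooth_on U (ddir v f)"
  unfolding smooth_on_def ddir_def by (metis differentiable_times_on.simps(2))

lemma smooth_on_imp_continuous_on: "smooth_on U f \<Longrightarrow> continuous_on U f"
  unfolding smooth_on_def by (metis differentiable_times_on.simps(1))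

lemma smooth_on_subset:
  assumes "smooth_on U f" "V \<subseteq> U"
  shows "smooth_on V f"
proof -
  have "differentiable_times_on r V f" if "differentiable_times_on r U f" for r
    using that assms(2) by (induction r arbitrary: f) (auto intro: continuous_on_subset)
  then show ?thesis
    using assms(1) by (simp add: smooth_on_def)
qed

section \<open>Affine substitutions and linear combinations\<close>

lemma ddir_affine:
  assumes "linear A" "f differentiable (at (c + A y))"
  shows "(\<lambda>y. f (c + A y)) differentiable (at y)"
    and "ddir v (\<lambda>y. f (c + A y)) y = ddir (A v) f (c + A y)"
proof -
  have "((\<lambda>y. c + A y) has_derivative A) (at y)"
    using assms(1) by (auto intro!: derivative_eq_intros linear_imp_has_derivative)
  moreover have "(f has_derivative frechet_derivative f (at (c + A y))) (at (c + A y))"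
    using assms(2) frechet_derivative_works by blast
  ultimately have *: "((\<lambda>y. f (c + A y)) has_derivative
      (\<lambda>v. frechet_derivative f (at (c + A y)) (A v))) (at y)"
    using has_derivative_compose by fastforce
  then show "(\<lambda>y. f (c + A y)) differentiable (at y)"
    by (auto simp: differentiable_def)
  show "ddir v (\<lambda>y. f (c + A y)) y = ddir (A v) f (c + A y)"
    using frechet_derivative_at[OF *] by (metis ddir_def)
qed

lemma open_affine_vimage:
  assumes "linear (A :: 'a::euclidean_space \<Rightarrow> 'b::euclidean_space)" "open U"
  shows "open {y. c + A y \<in> U}"
proof -
  have "continuous_on UNIV (\<lambda>y. c + A y)"
    using assms(1) by (intro continuous_intros linear_continuous_on linear_conv_bounded_linear[THEN iffD1])
  then have "open ((\<lambda>y. c + A y) -` U)"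
    using assms(2) open_vimage by blast
  then show ?thesis by (simp add: vimage_def)
qed

text \<open>By the chain rule, the derivative of the composite along \<open>v\<close> is
  \<open>ddir (A v) f\<close> composed with the same affine map, so the induction lets
  \<open>f\<close> vary. The intended maps are slices of a product, such as
  \<open>c = (l, 0)\<close> with \<open>A v = (0, v)\<close>.\<close>

lemma smooth_on_affine:
  assumes A: "linear A" and U: "open U" and "smooth_on U f"
  shows "smooth_on {y. c + A y \<in> U} (\<lambda>y. f (c + A y))"
proof -
  have "differentiable_times_on r {y. c + A y \<in> U} (\<lambda>y. f (c + A y))" for r
    using \<open>smooth_on U f\<close>
  proof (induction r arbitrary: f)
    case 0
    have "continuous_on {y. c + A y \<in> U} (\<lambda>y. c + A y)"
      using A by (intro continuous_intros linear_continuous_on linear_conv_bounded_linear[THEN iffD1])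
    then show ?case
      using continuous_on_compose2[OF smooth_on_imp_continuous_on[OF 0]] by auto
  next
    case (Suc r)
    have "differentiable_times_on r {y. c + A y \<in> U} (ddir v (\<lambda>y. f (c + A y)))" for v
      by (rule differentiable_times_on_cong[OF _ _ Suc.IH[of "ddir (A v) f"]])
        (use Suc.prems in \<open>auto simp: ddir_affine(2)[OF A] smooth_on_imp_differentiable
           intro: smooth_on_ddir open_affine_vimage[OF A U]\<close>)
    moreover have "(\<lambda>y. f (c + A y)) differentiable (at y)" if "c + A y \<in> U" for y
      using ddir_affine(1)[OF A] Suc.prems smooth_on_imp_differentiable that by blast
    ultimately show ?case by (simp add: ddir_def)
  qed
  then show ?thesis by (simp add: smooth_on_def)
qed

lemma ddir_sum:
  assumes "finite I" "\<And>i. i \<in> I \<Longrightarrow> f i differentiable (at x)"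
  shows "ddir v (\<lambda>x. \<Sum>i\<in>I. c i * f i x) x = (\<Sum>i\<in>I. c i * ddir v (f i) x)"
proof -
  have "((\<lambda>x. \<Sum>i\<in>I. c i * f i x) has_derivative
      (\<lambda>v. \<Sum>i\<in>I. c i * frechet_derivative (f i) (at x) v)) (at x)"
    using assms frechet_derivative_works by (intro has_derivative_sum has_derivative_mult_right) blast
  from fun_cong[OF frechet_derivative_at[OF this]] show ?thesis by (simp add: ddir_def)
qed

lemma smooth_on_sum:
  assumes "open U" "finite I" "\<And>i. i \<in> I \<Longrightarrow> smooth_on U (f i)"
  shows "smooth_on U (\<lambda>x. \<Sum>i\<in>I. c i * f i x)"
proof -
  have "differentiable_times_on r U (\<lambda>x. \<Sum>i\<in>I. c i * f i x)" for r
    using assms(3)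
  proof (induction r arbitrary: f)
    case 0
    then show ?case
      by (simp add: smooth_on_imp_continuous_on continuous_on_mult_left continuous_on_sum)
  next
    case (Suc r)
    have diff: "f i differentiable (at x)" if "i \<in> I" "x \<in> U" for i x
      using Suc.prems smooth_on_imp_differentiable that by blast
    have "differentiable_times_on r U (ddir v (\<lambda>x. \<Sum>i\<in>I. c i * f i x))" for v
    proof (rule differentiable_times_on_cong[OF assms(1)])
      show "(\<Sum>i\<in>I. c i * ddir v (f i) x) = ddir v (\<lambda>x. \<Sum>i\<in>I. c i * f i x) x" if "x \<in> U" for x
        using ddir_sum[OF assms(2) diff] that by simp
      show "differentiable_times_on r U (\<lambda>x. \<Sum>i\<in>I. c i * ddir v (f i) x)"
        using Suc.prems by (intro Suc.IH smooth_on_ddir)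
    qed
    moreover have "(\<lambda>x. \<Sum>i\<in>I. c i * f i x) differentiable (at x)" if "x \<in> U" for x
      using assms(2) diff that by (intro differentiable_sum differentiable_mult differentiable_const) auto
    ultimately show ?case by (simp add: ddir_def)
  qed
  then show ?thesis by (simp add: smooth_on_def)
qed

section \<open>Restriction to lines and symmetry of second derivatives\<close>

lemma has_real_derivative_line:
  assumes "f differentiable (at (x + t *\<^sub>R v))"
  shows "((\<lambda>t. f (x + t *\<^sub>R v)) has_real_derivative ddir v f (x + t *\<^sub>R v)) (at t)"
proof -
  let ?D = "frechet_derivative f (at (x + t *\<^sub>R v))"
  have "((\<lambda>t. x + t *\<^sub>R v) has_derivative (\<lambda>t. t *\<^sub>R v)) (at t)"
    by (auto intro!: derivative_eq_intros)
  moreover have "(f has_derivative ?D) (at (x + t *\<^sub>R v))"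
    using assms frechet_derivative_works by blast
  ultimately have "((\<lambda>t. f (x + t *\<^sub>R v)) has_derivative (\<lambda>s. ?D (s *\<^sub>R v))) (at t)"
    using has_derivative_compose by fastforce
  moreover have "?D (s *\<^sub>R v) = s * ?D v" for s
    using linear_frechet_derivative[OF assms] by (simp add: linear_cmul)
  ultimately show ?thesis
    by (simp add: has_field_derivative_def ddir_def mult_commute_abs)
qed

text \<open>The mean value theorem is used twice: for the increment of \<open>f\<close> along
  \<open>h *\<^sub>R w\<close> as a function of the step \<open>s\<close> along \<open>v\<close>,
  and then, at the \<open>s\<close> found, for \<open>ddir v f\<close> along
  \<open>w\<close>.\<close>

lemma second_difference_mvt:
  assumes "smooth_on U f" "0 < h"
    and U: "\<And>s t. 0 \<le> s \<Longrightarrow> s \<le> h \<Longrightarrow> 0 \<le> t \<Longrightarrow> t \<le> h \<Longrightarrow> x + s *\<^sub>R v + t *\<^sub>R w \<in> U"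
  obtains s t where "0 \<le> s" "s \<le> h" "0 \<le> t" "t \<le> h"
    "f (x + h *\<^sub>R v + h *\<^sub>R w) - f (x + h *\<^sub>R v) - f (x + h *\<^sub>R w) + f x
       = h * h * ddir w (ddir v f) (x + s *\<^sub>R v + t *\<^sub>R w)"
proof -
  let ?G = "\<lambda>s. f (x + h *\<^sub>R w + s *\<^sub>R v) - f (x + s *\<^sub>R v)"
  have U0: "x + s *\<^sub>R v \<in> U" if "0 \<le> s" "s \<le> h" for s
    using U[of s 0] that by simp
  have U1: "x + h *\<^sub>R w + s *\<^sub>R v \<in> U" if "0 \<le> s" "s \<le> h" for s
    using U[of s h] that assms(2) by (simp add: add_ac)
  have "(?G has_real_derivative
      (ddir v f (x + h *\<^sub>R w + s *\<^sub>R v) - ddir v f (x + s *\<^sub>R v))) (at s)"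
    if "0 \<le> s" "s \<le> h" for s
    using that U0 U1 assms(1)
    by (intro derivative_intros has_real_derivative_line) (auto intro: smooth_on_imp_differentiable)
  from MVT2[OF \<open>0 < h\<close> this] obtain s where s: "0 < s" "s < h"
    "?G h - ?G 0 = h * (ddir v f (x + h *\<^sub>R w + s *\<^sub>R v) - ddir v f (x + s *\<^sub>R v))"
    by auto
  have "((\<lambda>t. ddir v f (x + s *\<^sub>R v + t *\<^sub>R w)) has_real_derivative
      ddir w (ddir v f) (x + s *\<^sub>R v + t *\<^sub>R w)) (at t)"
    if "0 \<le> t" "t \<le> h" for t
    using that U[of s t] s smooth_on_ddir[OF assms(1)]
    by (intro has_real_derivative_line) (auto intro: smooth_on_imp_differentiable)
  from MVT2[OF \<open>0 < h\<close> this] obtain t where t: "0 < t" "t < h"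
    "ddir v f (x + s *\<^sub>R v + h *\<^sub>R w) - ddir v f (x + s *\<^sub>R v)
       = h * ddir w (ddir v f) (x + s *\<^sub>R v + t *\<^sub>R w)"
    by auto
  have "?G h - ?G 0 = h * h * ddir w (ddir v f) (x + s *\<^sub>R v + t *\<^sub>R w)"
    using s(3) t(3) by (simp add: add_ac)
  then show ?thesis
    using s t by (intro that[of s t]) (auto simp: add_ac)
qed

text \<open>By the mean value theorem the symmetric second difference over a small parallelogram at \<open>x\<close> is
  \<open>h\<^sup>2\<close> times a value near \<open>x\<close> of either mixed derivative, so both agree in the limit.\<close>

lemma ddir_commute:
  assumes "open U" "smooth_on U f" "x \<in> U"
  shows "ddir v (ddir w f) x = ddir w (ddir v f) x"
proof (rule ccontr)
  let ?A = "ddir v (ddir w f)" and ?B = "ddir w (ddir v f)"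
  assume ne: "?A x \<noteq> ?B x"
  \<comment> \<open>Half the gap: a number within \<open>e\<close> of both values would force them
    closer than \<open>2 * e\<close>, which is the gap itself.\<close>
  define e where "e = \<bar>?A x - ?B x\<bar> / 2"
  have "e > 0" using ne by (simp add: e_def)
  have "continuous_on U ?A" "continuous_on U ?B"
    using assms by (auto intro: smooth_on_ddir smooth_on_imp_continuous_on)
  then have "isCont ?A x" "isCont ?B x"
    using assms continuous_on_eq_continuous_at by blast+
  then obtain d1 d2 where d1: "d1 > 0" "\<And>y. dist y x < d1 \<Longrightarrow> dist (?A y) (?A x) < e"
    and d2: "d2 > 0" "\<And>y. dist y x < d2 \<Longrightarrow> dist (?B y) (?B x) < e"
    unfolding continuous_at_eps_delta using \<open>e > 0\<close> by blast
  obtain d3 where d3: "d3 > 0" "\<And>y. dist y x < d3 \<Longrightarrow> y \<in> U"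
    using assms by (metis open_dist)
  define d where "d = min d1 (min d2 d3)"
  have "d > 0" using d1 d2 d3 by (simp add: d_def)
  \<comment> \<open>Keeps the parallelogram with sides \<open>h *\<^sub>R v\<close> and
    \<open>h *\<^sub>R w\<close> inside the ball of radius \<open>d\<close>; the summand 1 makes the
    denominator positive when \<open>v\<close> and \<open>w\<close> both vanish.\<close>
  define h where "h = d / (norm v + norm w + 1)"
  have "norm v + norm w + 1 > 0" by (simp add: add_nonneg_pos)
  then have "h > 0" using \<open>d > 0\<close> by (simp add: h_def)
  have "h * (norm v + norm w + 1) = d" using \<open>norm v + norm w + 1 > 0\<close> by (simp add: h_def)
  then have h: "h * norm v + h * norm w < d" using \<open>h > 0\<close> by (simp add: algebra_simps)
  have near: "dist (x + s *\<^sub>R v + t *\<^sub>R w) x < d" "dist (x + s *\<^sub>R w + t *\<^sub>R v) x < d"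
    if "0 \<le> s" "s \<le> h" "0 \<le> t" "t \<le> h" for s t
  proof -
    have "norm (s *\<^sub>R v + t *\<^sub>R w) \<le> s * norm v + t * norm w"
      using that norm_triangle_ineq[of "s *\<^sub>R v" "t *\<^sub>R w"] by simp
    also have "\<dots> \<le> h * norm v + h * norm w"
      using that by (intro add_mono mult_right_mono) auto
    finally show "dist (x + s *\<^sub>R v + t *\<^sub>R w) x < d"
      using h by (simp add: dist_norm add_ac)
    have "norm (s *\<^sub>R w + t *\<^sub>R v) \<le> s * norm w + t * norm v"
      using that norm_triangle_ineq[of "s *\<^sub>R w" "t *\<^sub>R v"] by simp
    also have "\<dots> \<le> h * norm w + h * norm v"
      using that by (intro add_mono mult_right_mono) auto
    finally show "dist (x + s *\<^sub>R w + t *\<^sub>R v) x < d"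
      using h by (simp add: dist_norm add_ac)
  qed
  have inU: "y \<in> U" if "dist y x < d" for y using that d3(2) by (simp add: d_def)
  obtain s t where st: "0 \<le> s" "s \<le> h" "0 \<le> t" "t \<le> h"
    "f (x + h *\<^sub>R v + h *\<^sub>R w) - f (x + h *\<^sub>R v) - f (x + h *\<^sub>R w) + f x
       = h * h * ?B (x + s *\<^sub>R v + t *\<^sub>R w)"
    using second_difference_mvt[OF assms(2) \<open>h > 0\<close>, of x v w] near(1) inU by blast
  obtain s' t' where st': "0 \<le> s'" "s' \<le> h" "0 \<le> t'" "t' \<le> h"
    "f (x + h *\<^sub>R w + h *\<^sub>R v) - f (x + h *\<^sub>R w) - f (x + h *\<^sub>R v) + f x
       = h * h * ?A (x + s' *\<^sub>R w + t' *\<^sub>R v)"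
    using second_difference_mvt[OF assms(2) \<open>h > 0\<close>, of x w v] near(2) inU by blast
  \<comment> \<open>The second difference is symmetric in \<open>v\<close> and \<open>w\<close>, so
    both evaluations give the same number.\<close>
  have "h * h * ?A (x + s' *\<^sub>R w + t' *\<^sub>R v) = h * h * ?B (x + s *\<^sub>R v + t *\<^sub>R w)"
    unfolding st(5)[symmetric] st'(5)[symmetric] by (simp add: add_ac)
  then have eq: "?A (x + s' *\<^sub>R w + t' *\<^sub>R v) = ?B (x + s *\<^sub>R v + t *\<^sub>R w)"
    using \<open>h > 0\<close> by simp
  have "dist (?A (x + s' *\<^sub>R w + t' *\<^sub>R v)) (?A x) < e"
    using near(2)[OF st'(1-4)] by (intro d1(2)) (simp add: d_def)
  moreover have "dist (?B (x + s *\<^sub>R v + t *\<^sub>R w)) (?B x) < e"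
    using near(1)[OF st(1-4)] by (intro d2(2)) (simp add: d_def)
  ultimately have "dist (?A x) (?B x) < 2 * e"
    unfolding eq
    by (rule dist_triangle_half_r[of "?B (x + s *\<^sub>R v + t *\<^sub>R w)" _ "2 * e", simplified])
  then show False
    by (simp add: e_def dist_real_def)
qed

section \<open>Iterated derivatives along lists of directions\<close>

definition ddirs :: "'a::euclidean_space list \<Rightarrow> ('a \<Rightarrow> real) \<Rightarrow> 'a \<Rightarrow> real" where
  "ddirs vs f = foldr ddir vs f"

lemma ddirs_simps [simp]:
  "ddirs [] f = f"
  "ddirs (v # vs) f = ddir v (ddirs vs f)"
  "ddirs (vs @ ws) f = ddirs vs (ddirs ws f)"
  by (simp_all add: ddirs_def)

lemma smooth_on_ddirs: "smooth_on U f \<Longrightarrow> smooth_on U (ddirs vs f)"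
  by (induction vs) (auto intro: smooth_on_ddir)

lemma ddirs_cong:
  assumes "open U" "x \<in> U" "\<And>y. y \<in> U \<Longrightarrow> f y = g y"
  shows "ddirs vs f x = ddirs vs g x"
  using assms(2) by (induction vs arbitrary: x) (auto intro: ddir_cong[OF assms(1)] assms(3))

lemma ddirs_ddir_commute:
  assumes "open U" "smooth_on U f" "x \<in> U"
  shows "ddirs vs (ddir v f) x = ddir v (ddirs vs f) x"
  using assms(3)
proof (induction vs arbitrary: x)
  case (Cons w vs)
  have "ddir w (ddirs vs (ddir v f)) x = ddir w (ddir v (ddirs vs f)) x"
    by (rule ddir_cong[OF assms(1) Cons.prems Cons.IH])
  also have "\<dots> = ddir v (ddir w (ddirs vs f)) x"
    using Cons.prems assms smooth_on_ddirs by (blast intro: ddir_commute)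
  finally show ?case by simp
qed simp

text \<open>The head \<open>v\<close> occurs in \<open>ws = as @ v # bs\<close>. The induction
  hypothesis, valid on all of \<open>U\<close>, rearranges the tail into \<open>as @ bs\<close>, and
  commutation then moves \<open>v\<close> past \<open>as\<close>.\<close>

lemma ddirs_perm:
  assumes "open U" "smooth_on U f" "x \<in> U" "mset vs = mset ws"
  shows "ddirs vs f x = ddirs ws f x"
  using assms(3,4)
proof (induction vs arbitrary: ws x)
  case (Cons v vs)
  then obtain as bs where ws: "ws = as @ v # bs"
    by (metis list.set_intros(1) set_mset_mset split_list)
  have "ddirs (v # vs) f x = ddir v (ddirs (as @ bs) f) x"
    unfolding ddirs_simps(2)
    by (rule ddir_cong[OF assms(1) Cons.prems(1) Cons.IH]) (use Cons.prems ws in auto)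
  also have "\<dots> = ddirs as (ddir v (ddirs bs f)) x"
    using ddirs_ddir_commute[OF assms(1) smooth_on_ddirs[OF assms(2)] Cons.prems(1), of as v bs]
    by simp
  finally show ?case by (simp add: ws)
qed simp

lemma ddirs_affine:
  assumes "linear A" "open U" "smooth_on U f" "c + A y \<in> U"
  shows "ddirs vs (\<lambda>y. f (c + A y)) y = ddirs (map A vs) f (c + A y)"
  using assms(4)
proof (induction vs arbitrary: y)
  case (Cons v vs)
  have "ddir v (ddirs vs (\<lambda>y. f (c + A y))) y = ddir v (\<lambda>y. ddirs (map A vs) f (c + A y)) y"
    by (rule ddir_cong[OF open_affine_vimage[OF assms(1,2)]]) (use Cons in auto)
  also have "\<dots> = ddir (A v) (ddirs (map A vs) f) (c + A y)"
    using Cons.prems assms smooth_on_ddirs smooth_on_imp_differentiable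
    by (intro ddir_affine(2)) blast+
  finally show ?case by simp
qed simp

lemma ddirs_sum:
  assumes "open U" "x \<in> U" "finite I" "\<And>i. i \<in> I \<Longrightarrow> smooth_on U (f i)"
  shows "ddirs vs (\<lambda>x. \<Sum>i\<in>I. c i * f i x) x = (\<Sum>i\<in>I. c i * ddirs vs (f i) x)"
  using assms(2)
proof (induction vs arbitrary: x)
  case (Cons v vs)
  have "ddir v (ddirs vs (\<lambda>x. \<Sum>i\<in>I. c i * f i x)) x
      = ddir v (\<lambda>x. \<Sum>i\<in>I. c i * ddirs vs (f i) x) x"
    by (rule ddir_cong[OF assms(1)]) (use Cons in auto)
  also have "\<dots> = (\<Sum>i\<in>I. c i * ddir v (ddirs vs (f i)) x)"
    using assms Cons.prems smooth_on_ddirs smooth_on_imp_differentiable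
    by (intro ddir_sum) blast+
  finally show ?case by simp
qed simp

subsection \<open>Multi-index derivatives\<close>

text \<open>Two functions appear because an iterated partial derivative is identified with a smooth
  function only on \<open>U\<close>; in this form the step can be repeated.\<close>

lemma partial_deriv_eq_ddir:
  assumes "open U" "smooth_on U f" "x \<in> U" "\<And>y. y \<in> U \<Longrightarrow> g y = f y"
  shows "partial_deriv i g x = ddir (axis i 1) f x"
proof -
  have "g differentiable (at (x + 0 *\<^sub>R axis i 1))"
    using smooth_on_cong[OF assms(1) _ assms(2), of g] smooth_on_imp_differentiable assms by force
  from has_real_derivative_line[OF this] have "partial_deriv i g x = ddir (axis i 1) g x"
    unfolding partial_deriv_def by (simp add: DERIV_imp_deriv)
  also have "\<dots> = ddir (axis i 1) f x"
    using assms by (intro ddir_cong) auto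
  finally show ?thesis .
qed

text \<open>The order of the coordinates copies that of \<open>mi_deriv\<close>, so passing from
  \<open>mi_deriv\<close> to \<open>ddirs\<close> requires no commutation of derivatives.\<close>

definition mi_dirs :: "('n::finite \<Rightarrow> nat) \<Rightarrow> (real^'n) list" where
  "mi_dirs k = concat (map (\<lambda>i. replicate (k i) (axis i 1)) coords)"

lemma distinct_coords: "distinct (coords :: 'n::finite list)"
  and set_coords: "set (coords :: 'n list) = UNIV"
proof -
  have "\<exists>xs :: 'n list. distinct xs \<and> set xs = UNIV"
    using finite_distinct_list[of "UNIV :: 'n set"] by auto
  then have "distinct (coords :: 'n list) \<and> set (coords :: 'n list) = UNIV"
    unfolding coords_def by (rule someI_ex)
  then show "distinct (coords :: 'n list)" "set (coords :: 'n list) = UNIV" by auto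
qed

text \<open>The multiset forgets the arbitrary order of \<open>coords\<close>, so raising one
  exponent just adds one axis vector.\<close>

lemma mset_mi_dirs: "mset (mi_dirs k) = (\<Sum>i\<in>UNIV. replicate_mset (k i) (axis i 1))"
proof -
  have "mset (mi_dirs k) = sum_list (map (\<lambda>i. replicate_mset (k i) (axis i 1)) coords)"
    by (simp add: mi_dirs_def mset_concat comp_def)
  then show ?thesis
    by (simp add: sum_list_distinct_conv_sum_set distinct_coords set_coords)
qed

lemma mset_mi_dirs_Suc:
  "mset (mi_dirs (k(i := Suc (k i)))) = mset (axis i 1 # mi_dirs k)"
  by (simp add: mset_mi_dirs sum.remove[of UNIV i])

lemma partial_deriv_funpow_eq_ddirs:
  assumes "open U" "smooth_on U f" "\<And>y. y \<in> U \<Longrightarrow> g y = f y" "x \<in> U"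
  shows "(partial_deriv i ^^ m) g x = ddirs (replicate m (axis i 1)) f x"
  using assms(4)
proof (induction m arbitrary: x)
  case (Suc m)
  have "partial_deriv i ((partial_deriv i ^^ m) g) x
      = ddir (axis i 1) (ddirs (replicate m (axis i 1)) f) x"
    by (rule partial_deriv_eq_ddir[OF assms(1) smooth_on_ddirs[OF assms(2)] Suc.prems Suc.IH])
  then show ?case by simp
qed (use assms in simp)

lemma mi_deriv_eq_ddirs:
  assumes "open U" "smooth_on U f" "x \<in> U" "\<And>y. y \<in> U \<Longrightarrow> g y = f y"
  shows "mi_deriv k g x = ddirs (mi_dirs k) f x"
proof -
  \<comment> \<open>Generalised from \<open>coords\<close> to any list of coordinates, to allow
    induction on the list.\<close>
  have "foldr (\<lambda>i. partial_deriv i ^^ k i) is g x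
      = ddirs (concat (map (\<lambda>i. replicate (k i) (axis i 1)) is)) f x" for "is"
    using assms(3)
  proof (induction "is" arbitrary: x)
    case (Cons i "is")
    have "(partial_deriv i ^^ k i) (foldr (\<lambda>i. partial_deriv i ^^ k i) is g) x
      = ddirs (replicate (k i) (axis i 1))
          (ddirs (concat (map (\<lambda>i. replicate (k i) (axis i 1)) is)) f) x"
      by (rule partial_deriv_funpow_eq_ddirs[OF assms(1) smooth_on_ddirs[OF assms(2)] Cons.IH Cons.prems])
    then show ?case by simp
  qed (use assms in simp)
  then show ?thesis by (simp add: mi_deriv_def mi_dirs_def)
qed

lemma smooth_on_mi_deriv:
  assumes "open U" "smooth_on U f"
  shows "smooth_on U (mi_deriv k f)"
  by (rule smooth_on_cong[OF assms(1) _ smooth_on_ddirs[OF assms(2), of "mi_dirs k"]])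
    (simp add: mi_deriv_eq_ddirs[OF assms])

lemma mi_deriv_cong:
  assumes "open U" "smooth_on U f" "x \<in> U" "\<And>y. y \<in> U \<Longrightarrow> g y = f y"
  shows "mi_deriv k g x = mi_deriv k f x"
  using mi_deriv_eq_ddirs[OF assms(1-3), of g] mi_deriv_eq_ddirs[OF assms(1-3), of f] assms(4) by simp

lemma mi_deriv_sum:
  assumes "open U" "x \<in> U" "finite I" "\<And>i. i \<in> I \<Longrightarrow> smooth_on U (f i)"
  shows "mi_deriv k (\<lambda>x. \<Sum>i\<in>I. c i * f i x) x = (\<Sum>i\<in>I. c i * mi_deriv k (f i) x)"
proof -
  have "mi_deriv k (\<lambda>x. \<Sum>i\<in>I. c i * f i x) x = ddirs (mi_dirs k) (\<lambda>x. \<Sum>i\<in>I. c i * f i x) x"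
    using mi_deriv_eq_ddirs[OF assms(1) smooth_on_sum[OF assms(1,3,4)] assms(2)] by simp
  also have "\<dots> = (\<Sum>i\<in>I. c i * ddirs (mi_dirs k) (f i) x)"
    using assms by (intro ddirs_sum) auto
  also have "\<dots> = (\<Sum>i\<in>I. c i * mi_deriv k (f i) x)"
    using assms by (intro sum.cong refl arg_cong2[where f = "(*)"] mi_deriv_eq_ddirs[symmetric]) auto
  finally show ?thesis .
qed

lemma mi_deriv_diff_sum:
  assumes "open U" "x \<in> U" "finite I" "smooth_on U g" "\<And>i. i \<in> I \<Longrightarrow> smooth_on U (f i)"
  shows "mi_deriv k (\<lambda>x. g x - (\<Sum>i\<in>I. c i * f i x)) x
    = mi_deriv k g x - (\<Sum>i\<in>I. c i * mi_deriv k (f i) x)"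
proof -
  \<comment> \<open>The difference becomes a single linear combination: \<open>None\<close> carries
    \<open>g\<close> with coefficient 1, and \<open>Some i\<close> carries \<open>f i\<close> with
    coefficient \<open>- c i\<close>.\<close>
  let ?J = "insert None (Some ` I)"
  let ?c = "\<lambda>j. case j of None \<Rightarrow> 1 | Some i \<Rightarrow> - c i"
  let ?f = "\<lambda>j. case j of None \<Rightarrow> g | Some i \<Rightarrow> f i"
  have split: "(\<Sum>j\<in>?J. ?c j * h (?f j)) = h g - (\<Sum>i\<in>I. c i * h (f i))" for h
    using assms(3) by (subst sum.insert) (auto simp: sum.reindex sum_negf)
  have "mi_deriv k (\<lambda>x. \<Sum>j\<in>?J. ?c j * ?f j x) x = (\<Sum>j\<in>?J. ?c j * mi_deriv k (?f j) x)"
    by (rule mi_deriv_sum[OF assms(1,2)]) (use assms in auto)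
  then show ?thesis
    using split[of "\<lambda>f. mi_deriv k f x"] split[of "\<lambda>f. f _"] by simp
qed

text \<open>Prepending \<open>axis i 1\<close> yields a list out of coordinate order;
  \<open>ddirs_perm\<close> puts it back in order.\<close>

lemma ddir_mi_deriv:
  assumes "open U" "smooth_on U f" "x \<in> U"
  shows "ddir (axis i 1) (mi_deriv k f) x = mi_deriv (k(i := Suc (k i))) f x"
proof -
  have "ddir (axis i 1) (mi_deriv k f) x = ddirs (axis i 1 # mi_dirs k) f x"
    unfolding ddirs_simps
    by (rule ddir_cong[OF assms(1,3)]) (simp add: mi_deriv_eq_ddirs[OF assms(1,2)])
  also have "\<dots> = mi_deriv (k(i := Suc (k i))) f x"
    using ddirs_perm[OF assms mset_mi_dirs_Suc[of k i]]
    by (simp add: mi_deriv_eq_ddirs[OF assms])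
  finally show ?thesis .
qed

lemma mi_deriv_zero [simp]: "mi_deriv (\<lambda>_. 0) f = f"
proof -
  have "foldr (\<lambda>i. id) is f = f" for "is" :: "'n list"
    by (induction "is") auto
  then show ?thesis by (simp add: mi_deriv_def id_def)
qed

lemma ddir_eq_sum_axis:
  assumes "f differentiable (at (x :: real^'n::finite))"
  shows "ddir v f x = (\<Sum>i\<in>UNIV. v $ i * ddir (axis i 1) f x)"
proof -
  have "linear (\<lambda>v. ddir v f x)"
    using linear_frechet_derivative[OF assms] by (simp add: ddir_def)
  then have "ddir (\<Sum>i\<in>UNIV. (v $ i) *\<^sub>R axis i 1) f x = (\<Sum>i\<in>UNIV. v $ i * ddir (axis i 1) f x)"
    by (subst linear_sum[of "\<lambda>v. ddir v f x"]) (simp_all add: linear_cmul[of "\<lambda>v. ddir v f x"])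
  then show ?thesis
    using basis_expansion[of v] by (simp add: scalar_mult_eq_scaleR)
qed

text \<open>On differentiable functions \<open>dir_op v\<close> is the derivative along
  \<open>v\<close>, by linearity in the direction; smoothness lets this be iterated.\<close>

lemma dir_op_funpow_eq_ddirs:
  assumes "open U" "smooth_on U f" "x \<in> U"
  shows "(dir_op v ^^ j) f x = ddirs (replicate j v) f x"
  using assms(3)
proof (induction j arbitrary: x)
  case (Suc j)
  have "dir_op v ((dir_op v ^^ j) f) x
      = (\<Sum>i\<in>UNIV. v $ i * ddir (axis i 1) (ddirs (replicate j v) f) x)"
    unfolding dir_op_def[of v "(dir_op v ^^ j) f"]
    using partial_deriv_eq_ddir[OF assms(1) smooth_on_ddirs[OF assms(2)] Suc.prems Suc.IH]
    by simp
  also have "\<dots> = ddir v (ddirs (replicate j v) f) x"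
    using smooth_on_imp_differentiable[OF smooth_on_ddirs[OF assms(2)] Suc.prems]
    by (rule ddir_eq_sum_axis[symmetric])
  finally show ?case by simp
qed simp

subsection \<open>Taylor's formula in several variables\<close>

lemma finite_mi_abs_eq [simp]: "finite {k :: 'n::finite \<Rightarrow> nat. mi_abs k = j}"
proof -
  have "k i \<le> mi_abs k" for k :: "'n \<Rightarrow> nat" and i
    unfolding mi_abs_def by (rule member_le_sum) auto
  then have "{k :: 'n \<Rightarrow> nat. mi_abs k = j} \<subseteq> (\<Pi>\<^sub>E i\<in>UNIV. {..j})"
    by (auto simp: PiE_UNIV_domain)
  then show ?thesis
    by (rule finite_subset) (intro finite_PiE; simp)
qed

lemma mi_abs_Suc: "mi_abs (k(i := Suc (k i))) = Suc (mi_abs k)"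
  by (simp add: mi_abs_def sum.remove[of UNIV i])

lemma mi_pow_Suc: "mi_pow v (k(i := Suc (k i))) = v $ i * mi_pow v k"
  by (simp add: mi_pow_def prod.remove[of UNIV i])

lemma mi_fact_Suc: "mi_fact (k(i := Suc (k i))) = real (Suc (k i)) * mi_fact k"
  by (simp add: mi_fact_def prod.remove[of UNIV i] algebra_simps)

lemma mi_fact_pos: "mi_fact k > 0"
  by (simp add: mi_fact_def prod_pos)

text \<open>The multinomial recursion. Raising \<open>k i\<close> multiplies the coefficient by
  \<open>v $ i / Suc (k i)\<close>, so a multi-index \<open>k\<close> of order \<open>Suc j\<close>
  receives the factor \<open>k i\<close> from each coordinate \<open>i\<close>, and these add up to
  \<open>Suc j\<close>.\<close>

lemma sum_mi_abs_Suc: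
  fixes b :: "('n::finite \<Rightarrow> nat) \<Rightarrow> real"
  shows "(\<Sum>k | mi_abs k = j. \<Sum>i\<in>UNIV. mi_pow v k / mi_fact k * (v $ i * b (k(i := Suc (k i)))))
    = real (Suc j) * (\<Sum>k | mi_abs k = Suc j. mi_pow v k / mi_fact k * b k)"
proof -
  let ?a = "\<lambda>k. mi_pow v k / mi_fact k"
  have *: "(\<Sum>k | mi_abs k = j. ?a k * (v $ i * b (k(i := Suc (k i)))))
      = (\<Sum>k | mi_abs k = Suc j. real (k i) * (?a k * b k))" for i
  proof -
    have "(\<Sum>k | mi_abs k = j. ?a k * (v $ i * b (k(i := Suc (k i)))))
        = (\<Sum>k | mi_abs k = Suc j \<and> k i > 0. real (k i) * (?a k * b k))"
    \<comment> \<open>Raising entry \<open>i\<close> is a bijection from order \<open>j\<close> onto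
      those multi-indices of order \<open>Suc j\<close> whose entry \<open>i\<close> is
      positive.\<close>
    proof (rule sum.reindex_bij_witness[of _ "\<lambda>k. k(i := k i - 1)" "\<lambda>k. k(i := Suc (k i))"])
      fix k :: "'n \<Rightarrow> nat"
      assume "k \<in> {k. mi_abs k = Suc j \<and> k i > 0}"
      then show "k(i := k i - 1) \<in> {k. mi_abs k = j}"
        using mi_abs_Suc[of "k(i := k i - 1)" i] by simp
    next
      fix k :: "'n \<Rightarrow> nat"
      let ?k = "k(i := Suc (k i))"
      have "real (?k i) * ?a ?k = ?a k * v $ i"
        using mi_fact_pos[of k] unfolding mi_pow_Suc mi_fact_Suc by (simp add: divide_simps)
      then show "real (?k i) * (?a ?k * b ?k) = ?a k * (v $ i * b ?k)"
        by (metis mult.assoc)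
    qed (auto simp: mi_abs_Suc)
    \<comment> \<open>The added terms have \<open>k i = 0\<close> and so vanish.\<close>
    also have "\<dots> = (\<Sum>k | mi_abs k = Suc j. real (k i) * (?a k * b k))"
      by (rule sum.mono_neutral_left) auto
    finally show ?thesis .
  qed
  have "(\<Sum>k | mi_abs k = j. \<Sum>i\<in>UNIV. ?a k * (v $ i * b (k(i := Suc (k i)))))
      = (\<Sum>k | mi_abs k = Suc j. \<Sum>i\<in>UNIV. real (k i) * (?a k * b k))"
    by (subst (1 2) sum.swap) (simp only: *)
  also have "\<dots> = (\<Sum>k | mi_abs k = Suc j. real (Suc j) * (?a k * b k))"
    by (rule sum.cong) (simp_all only: sum_distrib_right[symmetric] of_nat_sum[symmetric]
        mi_abs_def[symmetric] mem_Collect_eq)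
  finally show ?thesis by (simp add: sum_distrib_left)
qed

text \<open>The multinomial theorem for the commuting partial derivatives: the formula of degree
  \<open>j\<close> is differentiated along \<open>v\<close>, expanded over the axes, and regrouped
  by \<open>sum_mi_abs_Suc\<close>.\<close>

lemma ddirs_replicate_multinomial:
  assumes "open U" "smooth_on U f" "x \<in> U"
  shows "ddirs (replicate j v) f x / fact j
    = (\<Sum>k | mi_abs k = j. mi_pow v k / mi_fact k * mi_deriv k f x)"
  using assms(3)
proof (induction j arbitrary: x)
  case 0
  have "{k :: 'a \<Rightarrow> nat. mi_abs k = 0} = {\<lambda>_. 0}"
    by (auto simp: mi_abs_def)
  then show ?case by (simp add: mi_pow_def mi_fact_def)
next
  case (Suc j)
  have diff: "mi_deriv k f differentiable (at x)" for k
    using smooth_on_imp_differentiable[OF smooth_on_mi_deriv[OF assms(1,2)] Suc.prems] .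
  have "ddir v (ddirs (replicate j v) f) x
      = ddir v (\<lambda>x. \<Sum>k | mi_abs k = j. (fact j * (mi_pow v k / mi_fact k)) * mi_deriv k f x) x"
  proof (rule ddir_cong[OF assms(1) Suc.prems])
    fix y assume "y \<in> U"
    from Suc.IH[OF this] show "ddirs (replicate j v) f y
        = (\<Sum>k | mi_abs k = j. (fact j * (mi_pow v k / mi_fact k)) * mi_deriv k f y)"
      by (simp add: field_simps sum_distrib_left)
  qed
  also have "\<dots> = (\<Sum>k | mi_abs k = j. (fact j * (mi_pow v k / mi_fact k)) * ddir v (mi_deriv k f) x)"
    by (rule ddir_sum) (auto intro: diff)
  also have "\<dots> = fact j * (\<Sum>k | mi_abs k = j. \<Sum>i\<in>UNIV.
      mi_pow v k / mi_fact k * (v $ i * mi_deriv (k(i := Suc (k i))) f x))"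
    unfolding ddir_eq_sum_axis[OF diff, of v] ddir_mi_deriv[OF assms(1,2) Suc.prems]
    by (simp add: sum_distrib_left mult.assoc)
  also have "\<dots> = fact (Suc j) * (\<Sum>k | mi_abs k = Suc j. mi_pow v k / mi_fact k * mi_deriv k f x)"
    using sum_mi_abs_Suc[where b = "\<lambda>k. mi_deriv k f x" and v = v and j = j] by simp
  finally show ?case by (simp del: fact_Suc)
qed

lemma sum_mi_abs_less:
  "(\<Sum>k :: 'n::finite \<Rightarrow> nat | mi_abs k < p. g k) = (\<Sum>m<p. \<Sum>k | mi_abs k = m. g k)"
proof -
  have "{k :: 'n \<Rightarrow> nat. mi_abs k < p} = (\<Union>m<p. {k. mi_abs k = m})" by auto
  then show ?thesis by (simp only:) (subst sum.UNION_disjoint; auto)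
qed

lemma finite_mi_abs_less [simp]: "finite {k :: 'n::finite \<Rightarrow> nat. mi_abs k < p}"
proof -
  have "{k :: 'n \<Rightarrow> nat. mi_abs k < p} = (\<Union>m<p. {k. mi_abs k = m})" by auto
  then show ?thesis by simp
qed

text \<open>One-variable Taylor expansion along the segment, each directional derivative being
  expanded by the multinomial formula. A single point \<open>z\<close> serves all \<open>k\<close>
  of order \<open>p\<close>.\<close>

lemma multivariate_taylor_lagrange:
  fixes f :: "real^'n::finite \<Rightarrow> real"
  assumes "open U" "smooth_on U f" "closed_segment a b \<subseteq> U" "p > 0"
  obtains z where "z \<in> closed_segment a b"
    "f b = (\<Sum>k | mi_abs k < p. mi_pow (b - a) k / mi_fact k * mi_deriv k f a)
         + (\<Sum>k | mi_abs k = p. mi_pow (b - a) k / mi_fact k * mi_deriv k f z)"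
proof -
  let ?v = "b - a"
  \<comment> \<open>For \<open>t\<close> in the unit interval, \<open>d m\<close> is the
    \<open>m\<close>-th derivative of \<open>f\<close> along the segment from \<open>a\<close> to
    \<open>b\<close>.\<close>
  define d where "d m t = ddirs (replicate m ?v) f (a + t *\<^sub>R ?v)" for m t
  have seg: "a + t *\<^sub>R ?v \<in> closed_segment a b" if "0 \<le> t" "t \<le> 1" for t
    using that by (auto simp: closed_segment_def algebra_simps intro!: exI[of _ t])
  have "\<forall>m t. m < p \<and> 0 \<le> t \<and> t \<le> 1 \<longrightarrow> DERIV (d m) t :> d (Suc m) t"
  proof (intro allI impI)
    fix m t assume "m < p \<and> 0 \<le> t \<and> t \<le> (1::real)"
    then have "a + t *\<^sub>R ?v \<in> U" using seg assms(3) by blast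
    from smooth_on_imp_differentiable[OF smooth_on_ddirs[OF assms(2)] this]
    show "DERIV (d m) t :> d (Suc m) t"
      unfolding d_def replicate.simps ddirs_simps by (rule has_real_derivative_line)
  qed
  from Maclaurin[OF zero_less_one assms(4) refl this] obtain t where t: "0 < t" "t < 1"
    "d 0 1 = (\<Sum>m<p. d m 0 / fact m * 1 ^ m) + d p t / fact p * 1 ^ p"
    by auto
  let ?z = "a + t *\<^sub>R ?v"
  have z: "?z \<in> closed_segment a b" using seg t by simp
  have "a \<in> U" "?z \<in> U" using assms(3) z by auto
  have "f b = (\<Sum>m<p. ddirs (replicate m ?v) f a / fact m) + ddirs (replicate p ?v) f ?z / fact p"
    using t(3) by (simp add: d_def)
  then show ?thesis
    unfolding ddirs_replicate_multinomial[OF assms(1,2) \<open>a \<in> U\<close>]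
      ddirs_replicate_multinomial[OF assms(1,2) \<open>?z \<in> U\<close>] sum_mi_abs_less[symmetric]
    using that z by blast
qed

subsection \<open>Mixed derivatives in parameter and space variables\<close>

lemma mi_deriv_section_right:
  fixes \<Psi> :: "(real^'n::finite) \<times> (real^'m::finite) \<Rightarrow> real"
  assumes "open U" "smooth_on U \<Psi>"
  shows "open {x. (l, x) \<in> U}"
    and "smooth_on {x. (l, x) \<in> U} (\<lambda>x. \<Psi> (l, x))"
    and "(l, x) \<in> U \<Longrightarrow> mi_deriv k (\<lambda>x. \<Psi> (l, x)) x = ddirs (map (\<lambda>v. (0, v)) (mi_dirs k)) \<Psi> (l, x)"
proof -
  have lin: "linear (\<lambda>v :: real^'m. (0 :: real^'n, v))"
    by (auto intro!: linearI)
  show op: "open {x. (l, x) \<in> U}"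
    using open_affine_vimage[OF lin assms(1), of "(l, 0)"] by simp
  show sm: "smooth_on {x. (l, x) \<in> U} (\<lambda>x. \<Psi> (l, x))"
    using smooth_on_affine[OF lin assms, of "(l, 0)"] by simp
  show "mi_deriv k (\<lambda>x. \<Psi> (l, x)) x = ddirs (map (\<lambda>v. (0, v)) (mi_dirs k)) \<Psi> (l, x)"
    if "(l, x) \<in> U"
    using that mi_deriv_eq_ddirs[OF op sm] ddirs_affine[OF lin assms, of "(l, 0)" x] by simp
qed

lemma mi_deriv_section_left:
  fixes \<Psi> :: "(real^'n::finite) \<times> (real^'m::finite) \<Rightarrow> real"
  assumes "open U" "smooth_on U \<Psi>"
  shows "open {l. (l, x) \<in> U}"
    and "smooth_on {l. (l, x) \<in> U} (\<lambda>l. \<Psi> (l, x))"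
    and "(l, x) \<in> U \<Longrightarrow> mi_deriv k (\<lambda>l. \<Psi> (l, x)) l = ddirs (map (\<lambda>v. (v, 0)) (mi_dirs k)) \<Psi> (l, x)"
proof -
  have lin: "linear (\<lambda>v :: real^'n. (v, 0 :: real^'m))"
    by (auto intro!: linearI)
  show op: "open {l. (l, x) \<in> U}"
    using open_affine_vimage[OF lin assms(1), of "(0, x)"] by simp
  show sm: "smooth_on {l. (l, x) \<in> U} (\<lambda>l. \<Psi> (l, x))"
    using smooth_on_affine[OF lin assms, of "(0, x)"] by simp
  show "mi_deriv k (\<lambda>l. \<Psi> (l, x)) l = ddirs (map (\<lambda>v. (v, 0)) (mi_dirs k)) \<Psi> (l, x)"
    if "(l, x) \<in> U"
    using that mi_deriv_eq_ddirs[OF op sm] ddirs_affine[OF lin assms, of "(0, x)" l] by simp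
qed

text \<open>On the product space both sides are \<open>ddirs\<close> along the same directions in
  different orders, so \<open>ddirs_perm\<close> applies.\<close>

lemma mi_deriv_mixed_commute:
  fixes \<phi> :: "real^'n::finite \<Rightarrow> real^'m::finite \<Rightarrow> real"
  assumes "open U" "smooth_on U (\<lambda>(l, x). \<phi> l x)" "(l, x) \<in> U"
  shows "mi_deriv k2 (\<lambda>x. mi_deriv k1 (\<lambda>l. \<phi> l x) l) x = mi_deriv k1 (\<lambda>l. mi_deriv k2 (\<phi> l) x) l"
proof -
  let ?\<Phi> = "\<lambda>(l, x). \<phi> l x"
  let ?l = "map (\<lambda>v. (v, 0)) (mi_dirs k1) :: ((real^'n) \<times> (real^'m)) list"
  let ?x = "map (\<lambda>v. (0, v)) (mi_dirs k2) :: ((real^'n) \<times> (real^'m)) list"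
  note sl = smooth_on_ddirs[OF assms(2), of ?l] and sx = smooth_on_ddirs[OF assms(2), of ?x]
  \<comment> \<open>The inner derivative is rewritten on a whole open slice, since the outer one
    still has to be taken.\<close>
  have "mi_deriv k2 (\<lambda>x. mi_deriv k1 (\<lambda>l. \<phi> l x) l) x = mi_deriv k2 (\<lambda>x. ddirs ?l ?\<Phi> (l, x)) x"
    using assms(3) mi_deriv_section_left(3)[OF assms(1,2), of l _ k1]
    by (intro mi_deriv_cong[OF mi_deriv_section_right(1,2)[OF assms(1) sl]]) auto
  also have "\<dots> = ddirs (?x @ ?l) ?\<Phi> (l, x)"
    using mi_deriv_section_right(3)[OF assms(1) sl assms(3)] by simp
  also have "\<dots> = ddirs (?l @ ?x) ?\<Phi> (l, x)"
    by (rule ddirs_perm[OF assms]) simp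
  also have "\<dots> = mi_deriv k1 (\<lambda>l. ddirs ?x ?\<Phi> (l, x)) l"
    using mi_deriv_section_left(3)[OF assms(1) sx assms(3)] by simp
  also have "\<dots> = mi_deriv k1 (\<lambda>l. mi_deriv k2 (\<phi> l) x) l"
    using assms(3) mi_deriv_section_right(3)[OF assms(1,2), of _ x k2]
    by (intro mi_deriv_cong[OF mi_deriv_section_left(1,2)[OF assms(1) sx], symmetric]) auto
  finally show ?thesis .
qed

lemma smooth_on_section_mi_deriv_right:
  fixes \<phi> :: "real^'n::finite \<Rightarrow> real^'m::finite \<Rightarrow> real"
  assumes "open U" "smooth_on U (\<lambda>(l, x). \<phi> l x)"
  shows "smooth_on {l. (l, x) \<in> U} (\<lambda>l. mi_deriv k (\<phi> l) x)"
  using mi_deriv_section_right(3)[OF assms, of _ x k]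
  by (intro smooth_on_cong[OF mi_deriv_section_left(1)[OF assms] _
        mi_deriv_section_left(2)[OF assms(1) smooth_on_ddirs[OF assms(2)]]]) auto

lemma smooth_on_section_mi_deriv_left:
  fixes \<phi> :: "real^'n::finite \<Rightarrow> real^'m::finite \<Rightarrow> real"
  assumes "open U" "smooth_on U (\<lambda>(l, x). \<phi> l x)"
  shows "smooth_on {x. (l, x) \<in> U} (\<lambda>x. mi_deriv k (\<lambda>l. \<phi> l x) l)"
  using mi_deriv_section_left(3)[OF assms, of l _ k]
  by (intro smooth_on_cong[OF mi_deriv_section_right(1)[OF assms] _
        mi_deriv_section_right(2)[OF assms(1) smooth_on_ddirs[OF assms(2)]]]) auto

subsection \<open>Gevrey norms of the Taylor remainder\<close>

text \<open>Induction over the coordinates, using that \<open>fact a * fact b\<close> divides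
  \<open>fact (a + b)\<close>; hence the detour through the natural numbers.\<close>

lemma mi_fact_le: "mi_fact k \<le> fact (mi_abs k)"
proof -
  have "(\<Prod>i\<in>A. fact (k i)) \<le> (fact (\<Sum>i\<in>A. k i) :: nat)" if "finite A" for A
    using that
  proof (induction A)
    case (insert a A)
    have "fact (k a) * (\<Prod>i\<in>A. fact (k i)) \<le> fact (k a) * (fact (\<Sum>i\<in>A. k i) :: nat)"
      using insert.IH by simp
    also have "\<dots> \<le> fact (k a + (\<Sum>i\<in>A. k i))"
      by (rule dvd_imp_le[OF fact_fact_dvd_fact]) simp
    finally show ?case using insert.hyps by simp
  qed simp
  from this[of UNIV] have "real (\<Prod>i\<in>UNIV. fact (k i)) \<le> real (fact (\<Sum>i\<in>UNIV. k i))"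
    by (intro of_nat_mono) simp
  then show ?thesis by (simp add: mi_fact_def mi_abs_def)
qed

lemma abs_mi_pow_le: "\<bar>mi_pow v k\<bar> \<le> norm1 v ^ mi_abs k"
proof -
  have "\<bar>v $ i\<bar> \<le> norm1 v" for i
    unfolding norm1_def by (rule member_le_sum) auto
  then have "\<bar>mi_pow v k\<bar> \<le> (\<Prod>i\<in>UNIV. norm1 v ^ k i)"
    unfolding mi_pow_def abs_prod power_abs by (intro prod_mono) (auto intro: power_mono)
  then show ?thesis by (simp add: power_sum mi_abs_def)
qed

lemma norm1_nonneg: "0 \<le> norm1 v"
  by (simp add: norm1_def sum_nonneg)

lemma C0_norm_upper: "z \<in> K \<Longrightarrow> ennreal \<bar>f z\<bar> \<le> C0_norm K f"
  unfolding C0_norm_def by (rule SUP_upper)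

text \<open>The weights of the double norm factor into a \<lambda>-part and an x-part, so weighting
  the pointwise bound and summing over \<open>k2\<close> leaves terms of the double series. It
  serves with \<open>S\<close> the zero index for \<open>\<phi> l\<close>, one index for a Taylor
  coefficient, and all indices of order \<open>p\<close> for the remainder.\<close>

lemma gevrey_norm_le_norm2:
  fixes \<phi> :: "real^'n::finite \<Rightarrow> real^'m::finite \<Rightarrow> real"
  assumes "0 \<le> Q" "finite S"
    and bound: "\<And>k2 x. x \<in> K2 \<Longrightarrow> ennreal \<bar>mi_deriv k2 g x\<bar>
      \<le> (\<Sum>k\<in>S. ennreal (Q * (L1 ^ mi_abs k / mi_fact k) powr \<alpha>)
            * C0_norm K (\<lambda>(l, x). mi_deriv k (\<lambda>l'. mi_deriv k2 (\<phi> l') x) l))"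
  shows "gevrey_norm \<alpha> L2 K2 g \<le> ennreal Q * gevrey_norm2 \<alpha> L1 L2 K \<phi>"
proof -
  define W1 where "W1 k = (L1 ^ mi_abs k / mi_fact k) powr \<alpha>" for k :: "'n \<Rightarrow> nat"
  define W2 where "W2 k = (L2 ^ mi_abs k / mi_fact k) powr \<alpha>" for k :: "'m \<Rightarrow> nat"
  define M where "M k1 k2 = C0_norm K (\<lambda>(l, x). mi_deriv k1 (\<lambda>l'. mi_deriv k2 (\<phi> l') x) l)" for k1 k2
  have W: "(L1 ^ mi_abs k1 * L2 ^ mi_abs k2 / (mi_fact k1 * mi_fact k2)) powr \<alpha> = W1 k1 * W2 k2"
    for k1 k2
    unfolding W1_def W2_def powr_mult[symmetric] by simp
  have W_nonneg: "W1 k1 \<ge> 0" "W2 k2 \<ge> 0" for k1 k2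
    by (simp_all add: W1_def W2_def)
  \<comment> \<open>A series of nonnegative terms is the supremum of its finite partial sums, so a
    bound uniform in \<open>F\<close> suffices.\<close>
  have "(\<Sum>k2\<in>F. ennreal (W2 k2) * C0_norm K2 (mi_deriv k2 g))
      \<le> ennreal Q * gevrey_norm2 \<alpha> L1 L2 K \<phi>" if "finite F" for F
  proof -
    have "C0_norm K2 (mi_deriv k2 g) \<le> (\<Sum>k\<in>S. ennreal (Q * W1 k) * M k k2)" for k2
      unfolding C0_norm_def[of K2] W1_def M_def by (intro SUP_least bound)
    then have "(\<Sum>k2\<in>F. ennreal (W2 k2) * C0_norm K2 (mi_deriv k2 g))
        \<le> (\<Sum>k2\<in>F. ennreal (W2 k2) * (\<Sum>k\<in>S. ennreal (Q * W1 k) * M k k2))"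
      by (intro sum_mono mult_left_mono) auto
    also have "\<dots> = ennreal Q * (\<Sum>k2\<in>F. \<Sum>k\<in>S. ennreal (W1 k * W2 k2) * M k k2)"
      using assms(1) W_nonneg by (simp add: sum_distrib_left ennreal_mult mult_ac)
    also have "(\<Sum>k2\<in>F. \<Sum>k\<in>S. ennreal (W1 k * W2 k2) * M k k2)
        = (\<Sum>(k, k2)\<in>S \<times> F. ennreal (W1 k * W2 k2) * M k k2)"
      by (subst sum.swap) (simp add: sum.cartesian_product)
    also have "\<dots> \<le> gevrey_norm2 \<alpha> L1 L2 K \<phi>"
      unfolding gevrey_norm2_def W M_def[symmetric]
      by (subst nonneg_infsum_complete) (use that assms(2) in \<open>auto intro!: SUP_upper\<close>)
    finally show ?thesis by (simp add: mult_left_mono)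
  qed
  then show ?thesis
    unfolding gevrey_norm_def W2_def[symmetric]
    by (subst nonneg_infsum_complete) (auto intro!: SUP_least)
qed

text \<open>The intermediate point in Lagrange's form depends on \<open>k2\<close> and
  \<open>x\<close>, but convexity keeps it in \<open>K1\<close>, and \<open>C0_norm\<close> is a
  supremum over all of \<open>K1 \<times> K2\<close>.\<close>

lemma taylor_remainder_mi_deriv:
  fixes \<phi> :: "real^'n::finite \<Rightarrow> real^'m::finite \<Rightarrow> real"
  assumes U: "open U" "smooth_on U (\<lambda>(l, x). \<phi> l x)"
    and "K1 \<times> K2 \<subseteq> U" "convex K1" "l \<in> K1" "l0 \<in> K1" "x \<in> K2" "p > 0"
  shows "ennreal \<bar>mi_deriv k2 (\<lambda>x. \<phi> l x
            - (\<Sum>k | mi_abs k < p. mi_pow (l - l0) k * taylor_coeff \<phi> l0 k x)) x\<bar>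
    \<le> (\<Sum>k | mi_abs k = p. ennreal (\<bar>mi_pow (l - l0) k\<bar> / mi_fact k)
          * C0_norm (K1 \<times> K2) (\<lambda>(l, x). mi_deriv k (\<lambda>l'. mi_deriv k2 (\<phi> l') x) l))"
proof -
  let ?\<Delta> = "l - l0" and ?h = "\<lambda>l. mi_deriv k2 (\<phi> l) x"
  \<comment> \<open>The remainder involves both \<open>\<phi> l\<close> and derivatives at
    \<open>l0\<close>, so smoothness in \<open>x\<close> is wanted on both slices at once.\<close>
  let ?V = "{x. (l, x) \<in> U} \<inter> {x. (l0, x) \<in> U}"
  have V: "open ?V" "x \<in> ?V"
    using mi_deriv_section_right(1)[OF U] assms(3,5,6,7) by auto
  have smV: "smooth_on ?V (\<phi> l)" "smooth_on ?V (\<lambda>x. mi_deriv k (\<lambda>l. \<phi> l x) l0)" for k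
    using mi_deriv_section_right(2)[OF U, of l] smooth_on_section_mi_deriv_left[OF U, of l0 k]
    by (auto intro: smooth_on_subset)
  have seg: "closed_segment l0 l \<subseteq> K1"
    using assms(4-6) by (simp add: closed_segment_subset)
  then have "closed_segment l0 l \<subseteq> {l. (l, x) \<in> U}"
    using assms(3,7) by auto
  from multivariate_taylor_lagrange[OF mi_deriv_section_left(1)[OF U]
      smooth_on_section_mi_deriv_right[OF U] this \<open>p > 0\<close>]
  obtain z where z: "z \<in> closed_segment l0 l"
    "?h l = (\<Sum>k | mi_abs k < p. mi_pow ?\<Delta> k / mi_fact k * mi_deriv k ?h l0)
          + (\<Sum>k | mi_abs k = p. mi_pow ?\<Delta> k / mi_fact k * mi_deriv k ?h z)"
    by blast
  have "mi_deriv k2 (\<lambda>x. \<phi> l x - (\<Sum>k | mi_abs k < p. mi_pow ?\<Delta> k * taylor_coeff \<phi> l0 k x)) x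
    = mi_deriv k2 (\<lambda>x. \<phi> l x - (\<Sum>k | mi_abs k < p.
        mi_pow ?\<Delta> k / mi_fact k * mi_deriv k (\<lambda>l. \<phi> l x) l0)) x"
    by (simp add: taylor_coeff_def)
  also have "\<dots> = ?h l - (\<Sum>k | mi_abs k < p.
      mi_pow ?\<Delta> k / mi_fact k * mi_deriv k2 (\<lambda>x. mi_deriv k (\<lambda>l. \<phi> l x) l0) x)"
    by (rule mi_deriv_diff_sum[OF V]) (auto intro: smV)
  also have "\<dots> = ?h l - (\<Sum>k | mi_abs k < p. mi_pow ?\<Delta> k / mi_fact k * mi_deriv k ?h l0)"
    using mi_deriv_mixed_commute[OF U, of l0 x k2] V(2) by simp
  also have "\<dots> = (\<Sum>k | mi_abs k = p. mi_pow ?\<Delta> k / mi_fact k * mi_deriv k ?h z)"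
    using z(2) by simp
  finally have R: "\<bar>mi_deriv k2 (\<lambda>x. \<phi> l x
      - (\<Sum>k | mi_abs k < p. mi_pow ?\<Delta> k * taylor_coeff \<phi> l0 k x)) x\<bar>
    \<le> (\<Sum>k | mi_abs k = p. \<bar>mi_pow ?\<Delta> k\<bar> / mi_fact k * \<bar>mi_deriv k ?h z\<bar>)"
    using sum_abs[of "\<lambda>k. mi_pow ?\<Delta> k / mi_fact k * mi_deriv k ?h z" "{k. mi_abs k = p}"]
      by (simp add: abs_mult abs_of_pos[OF mi_fact_pos])
  have "ennreal \<bar>mi_deriv k ?h z\<bar>
      \<le> C0_norm (K1 \<times> K2) (\<lambda>(l, x). mi_deriv k (\<lambda>l'. mi_deriv k2 (\<phi> l') x) l)" for k
    using C0_norm_upper[of "(z, x)" "K1 \<times> K2"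
        "\<lambda>(l, x). mi_deriv k (\<lambda>l'. mi_deriv k2 (\<phi> l') x) l"] z(1) seg assms(7)
    by auto
  then have le: "(\<Sum>k | mi_abs k = p. ennreal (\<bar>mi_pow ?\<Delta> k\<bar> / mi_fact k) * ennreal \<bar>mi_deriv k ?h z\<bar>)
      \<le> (\<Sum>k | mi_abs k = p. ennreal (\<bar>mi_pow ?\<Delta> k\<bar> / mi_fact k)
          * C0_norm (K1 \<times> K2) (\<lambda>(l, x). mi_deriv k (\<lambda>l'. mi_deriv k2 (\<phi> l') x) l))"
    by (intro sum_mono mult_left_mono) auto
  have eq: "ennreal (\<Sum>k | mi_abs k = p. \<bar>mi_pow ?\<Delta> k\<bar> / mi_fact k * \<bar>mi_deriv k ?h z\<bar>)
      = (\<Sum>k | mi_abs k = p. ennreal (\<bar>mi_pow ?\<Delta> k\<bar> / mi_fact k) * ennreal \<bar>mi_deriv k ?h z\<bar>)"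
    by (subst sum_ennreal[symmetric])
      (simp_all add: less_imp_le[OF mi_fact_pos] ennreal_mult[symmetric] del: times_divide_eq_left)
  show ?thesis
    by (rule order_trans[OF ennreal_leI[OF R] order_trans[OF eq_refl[OF eq] le]])
qed

text \<open>Write \<open>1 / k!\<close> as \<open>k!\<close> to the power \<alpha> - 1 over
  \<open>k!\<close> to the power \<alpha>, and enlarge the numerator using
  \<open>k! \<le> p!\<close>. The negative power of \<open>L\<close> cancels the one in the
  weight.\<close>

lemma taylor_weight_le:
  fixes v :: "real^'n::finite"
  assumes "\<alpha> > 1" "L > 0" "mi_abs k = p"
  shows "\<bar>mi_pow v k\<bar> / mi_fact k
    \<le> fact p powr (\<alpha> - 1) * L powr (- (real p * \<alpha>)) * norm1 v ^ p * (L ^ mi_abs k / mi_fact k) powr \<alpha>"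
proof -
  have F: "mi_fact k > 0" by (rule mi_fact_pos)
  have "(L ^ p) powr \<alpha> = L powr (real p * \<alpha>)"
    using assms(2) by (simp add: powr_powr flip: powr_realpow)
  then have "L powr (- (real p * \<alpha>)) * (L ^ mi_abs k / mi_fact k) powr \<alpha> = 1 / mi_fact k powr \<alpha>"
    using assms F by (simp add: powr_divide powr_minus field_simps)
  also have "\<dots> = 1 / (mi_fact k * mi_fact k powr (\<alpha> - 1))"
    using F by (simp add: powr_mult_base)
  finally have *: "L powr (- (real p * \<alpha>)) * (L ^ mi_abs k / mi_fact k) powr \<alpha>
      = 1 / (mi_fact k * mi_fact k powr (\<alpha> - 1))" .
  have "fact p powr (\<alpha> - 1) * L powr (- (real p * \<alpha>)) * norm1 v ^ p
      * (L ^ mi_abs k / mi_fact k) powr \<alpha>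
      = fact p powr (\<alpha> - 1) * norm1 v ^ p * (1 / (mi_fact k * mi_fact k powr (\<alpha> - 1)))"
    unfolding *[symmetric] by (simp only: mult_ac)
  also have "\<dots> = (fact p powr (\<alpha> - 1) / mi_fact k powr (\<alpha> - 1)) * (norm1 v ^ p / mi_fact k)"
    by simp
  also have "\<dots> \<ge> 1 * (\<bar>mi_pow v k\<bar> / mi_fact k)"
  proof (rule mult_mono)
    show "1 \<le> fact p powr (\<alpha> - 1) / mi_fact k powr (\<alpha> - 1)"
      using mi_fact_le[of k] F assms powr_mono2[of "\<alpha> - 1" "mi_fact k" "fact p"] by simp
    show "\<bar>mi_pow v k\<bar> / mi_fact k \<le> norm1 v ^ p / mi_fact k"
      using abs_mi_pow_le[of v k] F assms by (simp add: divide_right_mono)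
  qed (use F in auto)
  finally show ?thesis by simp
qed

section \<open>Taylor coefficients, membership in the Gevrey space, and the remainder bound\<close>

theorem proposition2p10:
  fixes \<alpha> L1 L2 :: real
    and K1 :: "(real^'n::finite) set"
    and P :: "'m::finite set"
    and K' K2 :: "(real^'m) set"
    and l0 :: "real^'n"
    and \<phi> :: "real^'n \<Rightarrow> real^'m \<Rightarrow> real"
  assumes "\<alpha> > 1" and "L1 > 0" and "L2 > 0"
    and "closed_cube K1"
    and "compact_base P K'" and "K2 = torus_lift P K'"
    and "l0 \<in> K1"
    and "\<phi> \<in> gevrey_space2 \<alpha> L1 L2 K1 P K'"
  shows "(\<forall>j v. \<forall>x\<in>K2. (1 / fact j) * (dir_op v ^^ j) (\<lambda>l. \<phi> l x) l0
            = (\<Sum>k | mi_abs k = j. mi_pow v k * taylor_coeff \<phi> l0 k x))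
       \<and> gevrey_asymptotic_expansion (gevrey_space \<alpha> L2 P K') (gevrey_norm \<alpha> L2 K2)
            \<alpha> L1 K1 \<phi> l0 (taylor_coeff \<phi> l0)"
proof
  let ?N = "gevrey_norm2 \<alpha> L1 L2 (K1 \<times> K2) \<phi>"
  let ?W = "\<lambda>k. (L1 ^ mi_abs k / mi_fact k) powr \<alpha>"
  obtain U where U: "open U" "smooth_on U (\<lambda>(l, x). \<phi> l x)" and KU: "K1 \<times> K2 \<subseteq> U"
    using assms(6,8) by (auto simp: gevrey_space2_def smooth_near_def)
  have per: "angle_periodic P (\<phi> l)" for l
    using assms(8) by (auto simp: gevrey_space2_def)
  have N: "?N < \<infinity>"
    using assms(6,8) by (auto simp: gevrey_space2_def)
  have "convex K1"
    using assms(4) by (auto simp: closed_cube_def)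
  have C0: "ennreal \<bar>mi_deriv k (\<lambda>l. mi_deriv k2 (\<phi> l) x) l\<bar>
      \<le> C0_norm (K1 \<times> K2) (\<lambda>(l, x). mi_deriv k (\<lambda>l'. mi_deriv k2 (\<phi> l') x) l)"
    if "l \<in> K1" "x \<in> K2" for l x k k2
    using C0_norm_upper[of "(l, x)" "K1 \<times> K2"
        "\<lambda>(l, x). mi_deriv k (\<lambda>l'. mi_deriv k2 (\<phi> l') x) l"] that by auto
  note norm_le = gevrey_norm_le_norm2[where K = "K1 \<times> K2" and \<phi> = \<phi> and \<alpha> = \<alpha>]
  have W_pos: "?W k > 0" for k :: "'n \<Rightarrow> nat"
    using assms(2) mi_fact_pos[of k] by simp

  show "\<forall>j v. \<forall>x\<in>K2. (1 / fact j) * (dir_op v ^^ j) (\<lambda>l. \<phi> l x) l0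
      = (\<Sum>k | mi_abs k = j. mi_pow v k * taylor_coeff \<phi> l0 k x)"
  proof (intro allI ballI)
    fix j v x assume "x \<in> K2"
    then have l0: "l0 \<in> {l. (l, x) \<in> U}" using KU assms(7) by auto
    have sm: "smooth_on {l. (l, x) \<in> U} (\<lambda>l. \<phi> l x)"
      using mi_deriv_section_left(2)[OF U, of x] by simp
    note op = mi_deriv_section_left(1)[OF U, of x]
    show "(1 / fact j) * (dir_op v ^^ j) (\<lambda>l. \<phi> l x) l0
      = (\<Sum>k | mi_abs k = j. mi_pow v k * taylor_coeff \<phi> l0 k x)"
      using ddirs_replicate_multinomial[OF op sm l0, of j v]
      by (simp add: dir_op_funpow_eq_ddirs[OF op sm l0] taylor_coeff_def)
  qed

  have "\<phi> l \<in> gevrey_space \<alpha> L2 P K'" if "l \<in> K1" for l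
  proof -
    have "smooth_near K2 (\<phi> l)"
      unfolding smooth_near_def
      using mi_deriv_section_right(1,2)[OF U, of l] KU that by (intro exI[of _ "{x. (l, x) \<in> U}"]) auto
    \<comment> \<open>The terms with zero \<lambda>-index alone dominate the norm of
      \<open>\<phi> l\<close>; their \<lambda>-weight is 1, hence the constant 1.\<close>
    moreover have "gevrey_norm \<alpha> L2 K2 (\<phi> l) \<le> ennreal 1 * ?N"
      using C0[OF that, of _ "\<lambda>_. 0"]
      by (intro norm_le[where S = "{\<lambda>_. 0}"]) (auto simp: mi_abs_def mi_fact_def)
    ultimately show ?thesis
      using per N assms(6) by (auto simp: gevrey_space_def order.strict_trans1)
  qed
  moreover have "taylor_coeff \<phi> l0 k \<in> gevrey_space \<alpha> L2 P K'" for k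
  proof -
    let ?V = "{x. (l0, x) \<in> U}"
    let ?d = "\<lambda>x. mi_deriv k (\<lambda>l. \<phi> l x) l0"
    \<comment> \<open>The scalar multiple is written as a one-term sum so that the lemmas on linear
      combinations apply.\<close>
    have c: "taylor_coeff \<phi> l0 k = (\<lambda>x. \<Sum>_\<in>(UNIV :: unit set). (1 / mi_fact k) * ?d x)"
      by (auto simp: taylor_coeff_def)
    have V: "open ?V" "K2 \<subseteq> ?V" and d: "smooth_on ?V ?d"
      using mi_deriv_section_right(1)[OF U, of l0] KU assms(7)
        smooth_on_section_mi_deriv_left[OF U, of l0 k] by auto
    have "smooth_near K2 (taylor_coeff \<phi> l0 k)"
      unfolding smooth_near_def c using V d by (intro exI[of _ ?V] conjI smooth_on_sum) simp_all
    moreover have "angle_periodic P (taylor_coeff \<phi> l0 k)"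
      using per by (simp add: angle_periodic_def taylor_coeff_def)
    \<comment> \<open>The constant times the weight of \<open>k\<close> is
      \<open>1 / mi_fact k\<close>, the factor in the Taylor coefficient.\<close>
    moreover have "gevrey_norm \<alpha> L2 K2 (taylor_coeff \<phi> l0 k) \<le> ennreal (1 / (mi_fact k * ?W k)) * ?N"
    proof (rule norm_le[where S = "{k}"])
      fix k2 x assume x: "x \<in> K2"
      have "mi_deriv k2 (taylor_coeff \<phi> l0 k) x = (1 / mi_fact k) * mi_deriv k2 ?d x"
        unfolding c using V x d by (subst mi_deriv_sum[OF V(1)]) auto
      also have "mi_deriv k2 ?d x = mi_deriv k (\<lambda>l. mi_deriv k2 (\<phi> l) x) l0"
        using mi_deriv_mixed_commute[OF U] V x by blast
      finally have "ennreal \<bar>mi_deriv k2 (taylor_coeff \<phi> l0 k) x\<bar>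
          = ennreal (1 / mi_fact k) * ennreal \<bar>mi_deriv k (\<lambda>l. mi_deriv k2 (\<phi> l) x) l0\<bar>"
        using mi_fact_pos[of k] by (simp add: abs_mult ennreal_mult[symmetric])
      also have "\<dots> \<le> ennreal (1 / mi_fact k)
          * C0_norm (K1 \<times> K2) (\<lambda>(l, x). mi_deriv k (\<lambda>l'. mi_deriv k2 (\<phi> l') x) l)"
        using C0[OF assms(7) x] by (intro mult_left_mono) auto
      also have "1 / mi_fact k = 1 / (mi_fact k * ?W k) * ?W k"
        using W_pos[of k] by simp
      finally show "ennreal \<bar>mi_deriv k2 (taylor_coeff \<phi> l0 k) x\<bar>
          \<le> (\<Sum>k'\<in>{k}. ennreal (1 / (mi_fact k * ?W k) * ?W k')
            * C0_norm (K1 \<times> K2) (\<lambda>(l, x). mi_deriv k' (\<lambda>l'. mi_deriv k2 (\<phi> l') x) l))"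
        by simp
    qed (use W_pos[of k] mi_fact_pos[of k] in auto)
    moreover have "ennreal (1 / (mi_fact k * ?W k)) * ?N < \<infinity>"
      using N by (simp add: ennreal_mult_less_top)
    ultimately show ?thesis
      using assms(6) by (auto simp: gevrey_space_def order.strict_trans1)
  qed
  \<comment> \<open>The constant \<open>enn2real ?N\<close> depends on neither \<open>l\<close> nor
    \<open>p\<close>, and it represents \<open>?N\<close> faithfully because \<open>?N\<close> is
    finite.\<close>
  moreover have "gevrey_norm \<alpha> L2 K2
      (\<lambda>x. \<phi> l x - (\<Sum>k | mi_abs k < p. mi_pow (l - l0) k * taylor_coeff \<phi> l0 k x))
    \<le> ennreal (enn2real ?N * fact p powr (\<alpha> - 1) * L1 powr (- (real p * \<alpha>)) * norm1 (l - l0) ^ p)"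
    if l: "l \<in> K1" and p: "p > 0" for l p
  proof -
    define Q where "Q = fact p powr (\<alpha> - 1) * L1 powr (- (real p * \<alpha>)) * norm1 (l - l0) ^ p"
    have Q: "Q \<ge> 0" by (simp add: Q_def norm1_nonneg)
    have "gevrey_norm \<alpha> L2 K2
        (\<lambda>x. \<phi> l x - (\<Sum>k | mi_abs k < p. mi_pow (l - l0) k * taylor_coeff \<phi> l0 k x)) \<le> ennreal Q * ?N"
    proof (rule norm_le[OF Q finite_mi_abs_eq])
      fix k2 x assume x: "x \<in> K2"
      show "ennreal \<bar>mi_deriv k2 (\<lambda>x. \<phi> l x
            - (\<Sum>k | mi_abs k < p. mi_pow (l - l0) k * taylor_coeff \<phi> l0 k x)) x\<bar>
        \<le> (\<Sum>k | mi_abs k = p. ennreal (Q * ?W k)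
          * C0_norm (K1 \<times> K2) (\<lambda>(l, x). mi_deriv k (\<lambda>l'. mi_deriv k2 (\<phi> l') x) l))"
        by (rule order_trans[OF taylor_remainder_mi_deriv[OF U KU \<open>convex K1\<close> l assms(7) x p]])
          (auto intro!: sum_mono mult_right_mono ennreal_leI
            simp: Q_def taylor_weight_le[OF assms(1,2)] simp del: times_divide_eq_right)
    qed
    also have "\<dots> = ennreal Q * ennreal (enn2real ?N)"
      using N by simp
    also have "\<dots> = ennreal (enn2real ?N * Q)"
      using Q by (simp add: ennreal_mult mult.commute)
    finally show ?thesis by (simp add: Q_def mult.assoc)
  qed
  ultimately show "gevrey_asymptotic_expansion (gevrey_space \<alpha> L2 P K') (gevrey_norm \<alpha> L2 K2)
      \<alpha> L1 K1 \<phi> l0 (taylor_coeff \<phi> l0)"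
    unfolding gevrey_asymptotic_expansion_def by blast
qed

end
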